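(* Let $\mathcal{C}$ be an $\mathbf{Ord}$-category with comma-objects and pullbacks, and let $\mathsf{T}=(T,\eta,\mu)$ be a lax idempotent $\mathbf{Ord}$-monad on $\mathcal{C}$. Suppose that for every morphism $f\colon X\to Y$ of $\mathcal{C}$ and every $u\colon Kf\to TKf$, the inequality $\kappa\cdot u\le\kappa\cdot\eta_{Kf}$ implies $u\le\eta_{Kf}$, where $\kappa\colon TKf\to T^2f\downarrow T\eta_Y$ is the comparison morphism. Then $\mathsf{T}$ is simple.
   Context: $\mathbf{Ord}$ is the category of posets and monotone maps. An $\mathbf{Ord}$-category is a locally small category whose hom-sets are posets and whose composition is monotone in each variable; an $\mathbf{Ord}$-functor is a functor monotone on hom-posets; an $\mathbf{Ord}$-monad is a monad whose functor part is an $\mathbf{Ord}$-functor. It is lax idempotent if $T\eta\le\eta T$. Limits are $\mathbf{Ord}$-enriched; the comma-object $f\downarrow g$ of $f\colon X\to Z\leftarrow Y\colon g$ is the universal object with projections $d_0,d_1$ to $X,Y$ such that $f\cdot d_0\le g\cdot d_1$, where for $h,k$ into $f\downarrow g$ one has $h\le k$ iff $d_0h\le d_0k$ and $d_1h\le d_1k$. For $f\colon X\to Y$ let $Kf=Tf\downarrow\eta_Y$ be the comma-object of $Tf\colon TX\to TY$ and $\eta_Y\colon Y\to TY$, with projections $q_f\colon Kf\to TX$, $Rf\colon Kf\to Y$ ($Tf\cdot q_f\le\eta_Y\cdot Rf$), and let $Lf\colon X\to Kf$ be the unique morphism with $q_f\cdot Lf=\eta_X$, $Rf\cdot Lf=f$.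 Let $T^2f\downarrow T\eta_Y$ be the comma-object of $T^2f\colon T^2X\to T^2Y$ and $T\eta_Y\colon TY\to T^2Y$ with projections $p_f$ to $T^2X$ and $p_Y$ to $TY$. The comparison morphism $\kappa$ is the unique morphism with $p_f\cdot\kappa=Tq_f$ and $p_Y\cdot\kappa=TRf$. An $\mathbf{Ord}$-monad $\mathsf{T}$ is simple if for every $f\colon X\to Y$ in $\mathcal{C}$ the inequality $F^{\mathsf T}(Lf)\cdot\varepsilon_{F^{\mathsf T}X}\cdot F^{\mathsf T}q_f\le 1$ holds in $\mathsf{T}\text{-Alg}$ ($F^{\mathsf T}$ the free algebra functor, $\varepsilon$ the counit of the free algebra adjunction; order on algebra morphisms inherited from $\mathcal{C}$), that is, $T(Lf)\cdot\mu_X\cdot Tq_f\le1_{TKf}$. *)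

theory Defs
  imports Main
begin

section \<open>\<open>Ord\<close>-categories and \<open>Ord\<close>-functors\<close>

record ('o, 'm) ordcat =
  Obj :: "'o set"
  Arr :: "'m set"
  Dom :: "'m \<Rightarrow> 'o"
  Cod :: "'m \<Rightarrow> 'o"
  Id :: "'o \<Rightarrow> 'm" ("\<one>\<index>")
  Comp :: "'m \<Rightarrow> 'm \<Rightarrow> 'm" (infixr "\<cdot>\<index>" 70)
  Le :: "'m \<Rightarrow> 'm \<Rightarrow> bool" (infix "\<sqsubseteq>\<index>" 50)

definition hom :: "('o, 'm, 'z) ordcat_scheme \<Rightarrow> 'o \<Rightarrow> 'o \<Rightarrow> 'm set" where
  "hom C X Y = {f \<in> Arr C. Dom C f = X \<and> Cod C f = Y}"

text \<open>
  Composition is written in the applicative order (\<open>g \<cdot> f\<close> is \<open>g\<close> after \<open>f\<close>). Values of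
  \<open>Comp\<close> on non-composable pairs and of \<open>Le\<close> on non-parallel pairs are unconstrained.
\<close>

locale ord_category =
  fixes C :: "('o, 'm, 'z) ordcat_scheme" (structure)
  assumes dom_obj: "f \<in> Arr C \<Longrightarrow> Dom C f \<in> Obj C"
    and cod_obj: "f \<in> Arr C \<Longrightarrow> Cod C f \<in> Obj C"
    and id_hom: "X \<in> Obj C \<Longrightarrow> \<one> X \<in> hom C X X"
    and comp_hom: "\<lbrakk>g \<in> hom C Y Z; f \<in> hom C X Y\<rbrakk> \<Longrightarrow> g \<cdot> f \<in> hom C X Z"
    and id_left: "f \<in> hom C X Y \<Longrightarrow> \<one> Y \<cdot> f = f"
    and id_right: "f \<in> hom C X Y \<Longrightarrow> f \<cdot> \<one> X = f"
    and comp_assoc: "\<lbrakk>h \<in> hom C Z W; g \<in> hom C Y Z; f \<in> hom C X Y\<rbrakk>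
        \<Longrightarrow> (h \<cdot> g) \<cdot> f = h \<cdot> (g \<cdot> f)"
    and hom_poset: "\<lbrakk>X \<in> Obj C; Y \<in> Obj C\<rbrakk>
        \<Longrightarrow> partial_order_on (hom C X Y) {(f, g). f \<in> hom C X Y \<and> g \<in> hom C X Y \<and> f \<sqsubseteq> g}"
    and comp_mono_left: "\<lbrakk>X \<in> Obj C; Y \<in> Obj C; Z \<in> Obj C; f \<in> hom C X Y\<rbrakk>
        \<Longrightarrow> monotone_on (hom C Y Z) (\<sqsubseteq>) (\<sqsubseteq>) (\<lambda>g. g \<cdot> f)"
    and comp_mono_right: "\<lbrakk>X \<in> Obj C; Y \<in> Obj C; Z \<in> Obj C; g \<in> hom C Y Z\<rbrakk>
        \<Longrightarrow> monotone_on (hom C X Y) (\<sqsubseteq>) (\<sqsubseteq>) (\<lambda>f. g \<cdot> f)"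

locale ord_functor =
  fixes C :: "('o, 'm, 'z) ordcat_scheme"
    and D :: "('p, 'n, 'w) ordcat_scheme"
    and Fo :: "'o \<Rightarrow> 'p"
    and Fa :: "'m \<Rightarrow> 'n"
  assumes obj_map: "X \<in> Obj C \<Longrightarrow> Fo X \<in> Obj D"
    and arr_map: "f \<in> hom C X Y \<Longrightarrow> Fa f \<in> hom D (Fo X) (Fo Y)"
    and map_id: "X \<in> Obj C \<Longrightarrow> Fa (\<one>\<^bsub>C\<^esub> X) = \<one>\<^bsub>D\<^esub> (Fo X)"
    and map_comp: "\<lbrakk>g \<in> hom C Y Z; f \<in> hom C X Y\<rbrakk>
        \<Longrightarrow> Fa (g \<cdot>\<^bsub>C\<^esub> f) = Fa g \<cdot>\<^bsub>D\<^esub> Fa f"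
    and map_mono: "\<lbrakk>X \<in> Obj C; Y \<in> Obj C\<rbrakk>
        \<Longrightarrow> monotone_on (hom C X Y) (Le C) (Le D) Fa"

section \<open>Enriched comma-objects and pullbacks\<close>

record ('o, 'm) span =
  apex :: 'o
  proj0 :: 'm
  proj1 :: 'm

definition is_comma :: "('o, 'm, 'z) ordcat_scheme \<Rightarrow> 'm \<Rightarrow> 'm \<Rightarrow> ('o, 'm) span \<Rightarrow> bool" where
  "is_comma C f g P \<longleftrightarrow>
     apex P \<in> Obj C \<and>
     proj0 P \<in> hom C (apex P) (Dom C f) \<and>
     proj1 P \<in> hom C (apex P) (Dom C g) \<and>
     f \<cdot>\<^bsub>C\<^esub> proj0 P \<sqsubseteq>\<^bsub>C\<^esub> g \<cdot>\<^bsub>C\<^esub> proj1 P \<and>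
     (\<forall>W \<in> Obj C. \<forall>a \<in> hom C W (Dom C f). \<forall>b \<in> hom C W (Dom C g).
        f \<cdot>\<^bsub>C\<^esub> a \<sqsubseteq>\<^bsub>C\<^esub> g \<cdot>\<^bsub>C\<^esub> b \<longrightarrow>
        (\<exists>!h. h \<in> hom C W (apex P) \<and> proj0 P \<cdot>\<^bsub>C\<^esub> h = a \<and> proj1 P \<cdot>\<^bsub>C\<^esub> h = b)) \<and>
     (\<forall>W \<in> Obj C. \<forall>h \<in> hom C W (apex P). \<forall>k \<in> hom C W (apex P).
        h \<sqsubseteq>\<^bsub>C\<^esub> k \<longleftrightarrow>
        proj0 P \<cdot>\<^bsub>C\<^esub> h \<sqsubseteq>\<^bsub>C\<^esub> proj0 P \<cdot>\<^bsub>C\<^esub> k \<and>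
        proj1 P \<cdot>\<^bsub>C\<^esub> h \<sqsubseteq>\<^bsub>C\<^esub> proj1 P \<cdot>\<^bsub>C\<^esub> k)"

definition is_pullback :: "('o, 'm, 'z) ordcat_scheme \<Rightarrow> 'm \<Rightarrow> 'm \<Rightarrow> ('o, 'm) span \<Rightarrow> bool" where
  "is_pullback C f g P \<longleftrightarrow>
     apex P \<in> Obj C \<and>
     proj0 P \<in> hom C (apex P) (Dom C f) \<and>
     proj1 P \<in> hom C (apex P) (Dom C g) \<and>
     f \<cdot>\<^bsub>C\<^esub> proj0 P = g \<cdot>\<^bsub>C\<^esub> proj1 P \<and>
     (\<forall>W \<in> Obj C. \<forall>a \<in> hom C W (Dom C f). \<forall>b \<in> hom C W (Dom C g).
        f \<cdot>\<^bsub>C\<^esub> a = g \<cdot>\<^bsub>C\<^esub> b \<longrightarrow>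
        (\<exists>!h. h \<in> hom C W (apex P) \<and> proj0 P \<cdot>\<^bsub>C\<^esub> h = a \<and> proj1 P \<cdot>\<^bsub>C\<^esub> h = b)) \<and>
     (\<forall>W \<in> Obj C. \<forall>h \<in> hom C W (apex P). \<forall>k \<in> hom C W (apex P).
        h \<sqsubseteq>\<^bsub>C\<^esub> k \<longleftrightarrow>
        proj0 P \<cdot>\<^bsub>C\<^esub> h \<sqsubseteq>\<^bsub>C\<^esub> proj0 P \<cdot>\<^bsub>C\<^esub> k \<and>
        proj1 P \<cdot>\<^bsub>C\<^esub> h \<sqsubseteq>\<^bsub>C\<^esub> proj1 P \<cdot>\<^bsub>C\<^esub> k)"

text \<open>
  Comma-objects are determined only up to isomorphism, and \<open>cm\<close> is an arbitrary choice of one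
  comma-object \<open>cm f g\<close> of \<open>f \<down> g\<close> for each cospan.
\<close>

definition comma_choice ::
    "('o, 'm, 'z) ordcat_scheme \<Rightarrow> ('m \<Rightarrow> 'm \<Rightarrow> ('o, 'm) span) \<Rightarrow> bool" where
  "comma_choice C cm \<longleftrightarrow>
     (\<forall>f \<in> Arr C. \<forall>g \<in> Arr C. Cod C f = Cod C g \<longrightarrow> is_comma C f g (cm f g))"

definition has_pullbacks :: "('o, 'm, 'z) ordcat_scheme \<Rightarrow> bool" where
  "has_pullbacks C \<longleftrightarrow>
     (\<forall>f \<in> Arr C. \<forall>g \<in> Arr C. Cod C f = Cod C g \<longrightarrow> (\<exists>P. is_pullback C f g P))"

section \<open>\<open>Ord\<close>-monads\<close>

record ('o, 'm) monad =
  tobj :: "'o \<Rightarrow> 'o"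
  tarr :: "'m \<Rightarrow> 'm"
  unit :: "'o \<Rightarrow> 'm"
  mult :: "'o \<Rightarrow> 'm"

locale ord_monad = ord_category C + ord_functor C C "tobj T" "tarr T"
  for C :: "('o, 'm, 'z) ordcat_scheme" (structure)
  and T :: "('o, 'm) monad" +
  assumes unit_hom: "X \<in> Obj C \<Longrightarrow> unit T X \<in> hom C X (tobj T X)"
    and mult_hom: "X \<in> Obj C \<Longrightarrow> mult T X \<in> hom C (tobj T (tobj T X)) (tobj T X)"
    and unit_natural: "f \<in> hom C X Y \<Longrightarrow> tarr T f \<cdot> unit T X = unit T Y \<cdot> f"
    and mult_natural: "f \<in> hom C X Y
        \<Longrightarrow> tarr T f \<cdot> mult T X = mult T Y \<cdot> tarr T (tarr T f)"
    and mult_unit: "X \<in> Obj C \<Longrightarrow> mult T X \<cdot> unit T (tobj T X) = \<one> (tobj T X)"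
    and mult_map_unit: "X \<in> Obj C \<Longrightarrow> mult T X \<cdot> tarr T (unit T X) = \<one> (tobj T X)"
    and mult_assoc: "X \<in> Obj C
        \<Longrightarrow> mult T X \<cdot> mult T (tobj T X) = mult T X \<cdot> tarr T (mult T X)"

locale lax_idempotent_ord_monad = ord_monad +
  assumes lax_idempotent: "X \<in> Obj C \<Longrightarrow> tarr T (unit T X) \<sqsubseteq> unit T (tobj T X)"

section \<open>The category of algebras and the free algebra adjunction\<close>

definition is_algebra :: "('o, 'm, 'z) ordcat_scheme \<Rightarrow> ('o, 'm) monad \<Rightarrow> 'o \<times> 'm \<Rightarrow> bool" where
  "is_algebra C T A \<longleftrightarrow> (case A of (X, a) \<Rightarrow>
     X \<in> Obj C \<and> a \<in> hom C (tobj T X) X \<and>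
     a \<cdot>\<^bsub>C\<^esub> unit T X = \<one>\<^bsub>C\<^esub> X \<and>
     a \<cdot>\<^bsub>C\<^esub> tarr T a = a \<cdot>\<^bsub>C\<^esub> mult T X)"

text \<open>
  A morphism of algebras carries its source and target algebras, since the underlying
  morphism of \<open>C\<close> does not determine them.
\<close>

definition alg_category ::
    "('o, 'm, 'z) ordcat_scheme \<Rightarrow> ('o, 'm) monad
     \<Rightarrow> ('o \<times> 'm, ('o \<times> 'm) \<times> 'm \<times> ('o \<times> 'm)) ordcat" where
  "alg_category C T = \<lparr>
     Obj = {A. is_algebra C T A},
     Arr = {(A, h, B). is_algebra C T A \<and> is_algebra C T B \<and> h \<in> hom C (fst A) (fst B) \<and>
                       h \<cdot>\<^bsub>C\<^esub> snd A = snd B \<cdot>\<^bsub>C\<^esub> tarr T h},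
     Dom = (\<lambda>(A, h, B). A),
     Cod = (\<lambda>(A, h, B). B),
     Id = (\<lambda>A. (A, \<one>\<^bsub>C\<^esub> (fst A), A)),
     Comp = (\<lambda>(B', k, D) (A, h, B). (A, k \<cdot>\<^bsub>C\<^esub> h, D)),
     Le = (\<lambda>(A, h, B) (A', k, B'). h \<sqsubseteq>\<^bsub>C\<^esub> k)\<rparr>"

definition free_alg :: "('o, 'm) monad \<Rightarrow> 'o \<Rightarrow> 'o \<times> 'm" where
  "free_alg T X = (tobj T X, mult T X)"

definition free_map ::
    "('o, 'm, 'z) ordcat_scheme \<Rightarrow> ('o, 'm) monad \<Rightarrow> 'm \<Rightarrow> ('o \<times> 'm) \<times> 'm \<times> ('o \<times> 'm)" where
  "free_map C T f = (free_alg T (Dom C f), tarr T f, free_alg T (Cod C f))"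

text \<open>The counit of the free-forgetful adjunction at \<open>(X, a)\<close> is \<open>a : (TX, \<mu>\<^sub>X) \<rightarrow> (X, a)\<close>.\<close>

definition alg_counit :: "('o, 'm) monad \<Rightarrow> 'o \<times> 'm \<Rightarrow> ('o \<times> 'm) \<times> 'm \<times> ('o \<times> 'm)" where
  "alg_counit T A = (free_alg T (fst A), snd A, A)"

section \<open>The factorisation \<open>f = Rf \<cdot> Lf\<close>, the comparison morphism, and simple monads\<close>

context
  fixes C :: "('o, 'm, 'z) ordcat_scheme" (structure)
    and cm :: "'m \<Rightarrow> 'm \<Rightarrow> ('o, 'm) span"
    and T :: "('o, 'm) monad"
begin

definition K_span :: "'m \<Rightarrow> ('o, 'm) span" where
  "K_span f = cm (tarr T f) (unit T (Cod C f))"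

definition K_obj :: "'m \<Rightarrow> 'o" where "K_obj f = apex (K_span f)"
definition q_arr :: "'m \<Rightarrow> 'm" where "q_arr f = proj0 (K_span f)"
definition R_arr :: "'m \<Rightarrow> 'm" where "R_arr f = proj1 (K_span f)"

definition L_arr :: "'m \<Rightarrow> 'm" where
  "L_arr f = (THE l. l \<in> hom C (Dom C f) (K_obj f) \<and>
                     q_arr f \<cdot> l = unit T (Dom C f) \<and> R_arr f \<cdot> l = f)"

definition T2_span :: "'m \<Rightarrow> ('o, 'm) span" where
  "T2_span f = cm (tarr T (tarr T f)) (tarr T (unit T (Cod C f)))"

definition kappa :: "'m \<Rightarrow> 'm" where
  "kappa f = (THE k. k \<in> hom C (tobj T (K_obj f)) (apex (T2_span f)) \<and>
                     proj0 (T2_span f) \<cdot> k = tarr T (q_arr f) \<and>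
                     proj1 (T2_span f) \<cdot> k = tarr T (R_arr f))"

definition simple :: bool where
  "simple \<longleftrightarrow> (\<forall>f \<in> Arr C.
     free_map C T (L_arr f)
       \<cdot>\<^bsub>alg_category C T\<^esub> alg_counit T (free_alg T (Dom C f))
       \<cdot>\<^bsub>alg_category C T\<^esub> free_map C T (q_arr f)
     \<sqsubseteq>\<^bsub>alg_category C T\<^esub> \<one>\<^bsub>alg_category C T\<^esub> (free_alg T (K_obj f)))"

lemma simple_iff:
  "simple \<longleftrightarrow> (\<forall>f \<in> Arr C.
     tarr T (L_arr f) \<cdot> mult T (Dom C f) \<cdot> tarr T (q_arr f) \<sqsubseteq> \<one> (tobj T (K_obj f)))"
  by (simp add: simple_def alg_category_def free_map_def alg_counit_def free_alg_def)

end

end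

theory Submission
  imports Defs
begin

text \<open>
  Put \<open>u = TLf \<cdot> q\<^sub>f\<close>. The projections of \<open>\<kappa> \<cdot> u\<close> are \<open>T\<eta>\<^sub>X \<cdot> q\<^sub>f \<le> \<eta>\<^bsub>TX\<^esub> \<cdot> q\<^sub>f = Tq\<^sub>f \<cdot> \<eta>\<^bsub>Kf\<^esub>\<close>
  (lax idempotency) and \<open>Tf \<cdot> q\<^sub>f \<le> \<eta>\<^sub>Y \<cdot> Rf = TRf \<cdot> \<eta>\<^bsub>Kf\<^esub>\<close> (the comma-object inequality), so
  \<open>\<kappa> \<cdot> u \<le> \<kappa> \<cdot> \<eta>\<^bsub>Kf\<^esub>\<close>. The hypothesis yields \<open>u \<le> \<eta>\<^bsub>Kf\<^esub>\<close>, and transposing to algebra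
  morphisms gives \<open>TLf \<cdot> \<mu>\<^sub>X \<cdot> Tq\<^sub>f = \<mu>\<^bsub>Kf\<^esub> \<cdot> Tu \<le> \<mu>\<^bsub>Kf\<^esub> \<cdot> T\<eta>\<^bsub>Kf\<^esub> = 1\<close>.
\<close>

lemma homD:
  assumes "f \<in> hom C X Y"
  shows "f \<in> Arr C" "Dom C f = X" "Cod C f = Y"
  using assms by (simp_all add: hom_def)

context ord_category
begin

lemma hom_objs:
  assumes "f \<in> hom C X Y"
  shows "X \<in> Obj C" "Y \<in> Obj C"
  using assms dom_obj cod_obj by (auto simp: hom_def)

lemma le_refl: "f \<in> hom C X Y \<Longrightarrow> f \<sqsubseteq> f"
  using hom_poset[of X Y] hom_objs[of f X Y]
  by (auto simp: partial_order_on_def preorder_on_def refl_on_def)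

lemma comp_le_left:
  assumes "g \<in> hom C Y Z" "g' \<in> hom C Y Z" "g \<sqsubseteq> g'" "f \<in> hom C X Y"
  shows "g \<cdot> f \<sqsubseteq> g' \<cdot> f"
  using monotone_onD[OF comp_mono_left] hom_objs assms by metis

lemma comp_le_right:
  assumes "f \<in> hom C X Y" "f' \<in> hom C X Y" "f \<sqsubseteq> f'" "g \<in> hom C Y Z"
  shows "g \<cdot> f \<sqsubseteq> g \<cdot> f'"
  using monotone_onD[OF comp_mono_right] hom_objs assms by metis

end

lemma is_comma_hom:
  assumes "is_comma C f g P" "f \<in> hom C X Z" "g \<in> hom C Y Z"
  shows "apex P \<in> Obj C" "proj0 P \<in> hom C (apex P) X" "proj1 P \<in> hom C (apex P) Y"
  using assms by (simp_all add: is_comma_def homD)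

lemma is_comma_le: "is_comma C f g P \<Longrightarrow> f \<cdot>\<^bsub>C\<^esub> proj0 P \<sqsubseteq>\<^bsub>C\<^esub> g \<cdot>\<^bsub>C\<^esub> proj1 P"
  by (simp add: is_comma_def)

lemma is_comma_ex1:
  assumes "is_comma C f g P" "f \<in> hom C X Z" "g \<in> hom C Y Z" "W \<in> Obj C"
    and "a \<in> hom C W X" "b \<in> hom C W Y" "f \<cdot>\<^bsub>C\<^esub> a \<sqsubseteq>\<^bsub>C\<^esub> g \<cdot>\<^bsub>C\<^esub> b"
  shows "\<exists>!h. h \<in> hom C W (apex P) \<and> proj0 P \<cdot>\<^bsub>C\<^esub> h = a \<and> proj1 P \<cdot>\<^bsub>C\<^esub> h = b"
  using assms by (simp add: is_comma_def homD)

text \<open>The order-enriched half of the universal property: inequalities into a comma-object are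
  tested on its two projections. The unique factorisations above form the other half.\<close>

lemma is_comma_leI:
  assumes "is_comma C f g P" "W \<in> Obj C" "h \<in> hom C W (apex P)" "k \<in> hom C W (apex P)"
    and "proj0 P \<cdot>\<^bsub>C\<^esub> h \<sqsubseteq>\<^bsub>C\<^esub> proj0 P \<cdot>\<^bsub>C\<^esub> k" "proj1 P \<cdot>\<^bsub>C\<^esub> h \<sqsubseteq>\<^bsub>C\<^esub> proj1 P \<cdot>\<^bsub>C\<^esub> k"
  shows "h \<sqsubseteq>\<^bsub>C\<^esub> k"
  using assms by (simp add: is_comma_def)

lemma (in ord_functor) arr_le:
  assumes "f \<in> hom C X Y" "g \<in> hom C X Y" "f \<sqsubseteq>\<^bsub>C\<^esub> g" "X \<in> Obj C" "Y \<in> Obj C"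
  shows "Fa f \<sqsubseteq>\<^bsub>D\<^esub> Fa g"
  using monotone_onD[OF map_mono] assms by metis

context ord_monad
begin

context
  fixes cm f X Y
  assumes cm: "comma_choice C cm" and f: "f \<in> hom C X Y"
begin

lemma obj_X: "X \<in> Obj C" and obj_Y: "Y \<in> Obj C"
  using hom_objs[OF f] .

lemma K_comma: "is_comma C (tarr T f) (unit T Y) (K_span C cm T f)"
  using cm arr_map[OF f] unit_hom[OF obj_Y] f
  by (auto simp: comma_choice_def K_span_def hom_def)

lemma K_obj_in: "K_obj C cm T f \<in> Obj C"
  and q_hom: "q_arr C cm T f \<in> hom C (K_obj C cm T f) (tobj T X)"
  and R_hom: "R_arr C cm T f \<in> hom C (K_obj C cm T f) Y"
  using is_comma_hom[OF K_comma arr_map[OF f] unit_hom[OF obj_Y]]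
  by (simp_all add: K_obj_def q_arr_def R_arr_def)

lemma q_le_R: "tarr T f \<cdot> q_arr C cm T f \<sqsubseteq> unit T Y \<cdot> R_arr C cm T f"
  using is_comma_le[OF K_comma] by (simp add: q_arr_def R_arr_def)

text \<open>Naturality of the unit at \<open>f\<close> makes (\<open>unit T X\<close>,
  \<open>f\<close>) a cone over the comma-object; reflexivity weakens that equation to the required
  inequality. The resulting unique existence gives the definite description \<open>L_arr\<close> its
  meaning.\<close>

lemma L_hom: "L_arr C cm T f \<in> hom C X (K_obj C cm T f)"
  and q_L: "q_arr C cm T f \<cdot> L_arr C cm T f = unit T X"
  and R_L: "R_arr C cm T f \<cdot> L_arr C cm T f = f"
proof -
  have "tarr T f \<cdot> unit T X \<sqsubseteq> unit T Y \<cdot> f"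
    using le_refl[OF comp_hom[OF unit_hom[OF obj_Y] f]] unit_natural[OF f] by simp
  then have "\<exists>!l. l \<in> hom C (Dom C f) (K_obj C cm T f) \<and>
      q_arr C cm T f \<cdot> l = unit T (Dom C f) \<and> R_arr C cm T f \<cdot> l = f"
    using is_comma_ex1[OF K_comma arr_map[OF f] unit_hom[OF obj_Y] obj_X unit_hom[OF obj_X] f]
    by (simp add: homD(2)[OF f] K_obj_def q_arr_def R_arr_def)
  from theI'[OF this]
  show "L_arr C cm T f \<in> hom C X (K_obj C cm T f)"
    and "q_arr C cm T f \<cdot> L_arr C cm T f = unit T X"
    and "R_arr C cm T f \<cdot> L_arr C cm T f = f"
    by (simp_all add: L_arr_def homD(2)[OF f])
qed

lemma T2_comma: "is_comma C (tarr T (tarr T f)) (tarr T (unit T Y)) (T2_span C cm T f)"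
  using cm arr_map[OF arr_map[OF f]] arr_map[OF unit_hom[OF obj_Y]] f
  by (auto simp: comma_choice_def T2_span_def hom_def)

lemmas T2_hom = is_comma_hom[OF T2_comma arr_map[OF arr_map[OF f]] arr_map[OF unit_hom[OF obj_Y]]]

lemma kappa_hom: "kappa C cm T f \<in> hom C (tobj T (K_obj C cm T f)) (apex (T2_span C cm T f))"
  and proj0_kappa: "proj0 (T2_span C cm T f) \<cdot> kappa C cm T f = tarr T (q_arr C cm T f)"
  and proj1_kappa: "proj1 (T2_span C cm T f) \<cdot> kappa C cm T f = tarr T (R_arr C cm T f)"
proof -
  \<comment> \<open>Monotonicity of \<open>T\<close> carries the defining inequality of
    \<open>Kf\<close> to the cone that \<open>kappa\<close> factorises.\<close>
  have "tarr T (tarr T f \<cdot> q_arr C cm T f) \<sqsubseteq> tarr T (unit T Y \<cdot> R_arr C cm T f)"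
    using arr_le[OF comp_hom[OF arr_map[OF f] q_hom] comp_hom[OF unit_hom[OF obj_Y] R_hom]
      q_le_R K_obj_in obj_map[OF obj_Y]] .
  then have "tarr T (tarr T f) \<cdot> tarr T (q_arr C cm T f)
      \<sqsubseteq> tarr T (unit T Y) \<cdot> tarr T (R_arr C cm T f)"
    using map_comp[OF arr_map[OF f] q_hom] map_comp[OF unit_hom[OF obj_Y] R_hom] by simp
  from theI'[OF is_comma_ex1[OF T2_comma arr_map[OF arr_map[OF f]] arr_map[OF unit_hom[OF obj_Y]]
    obj_map[OF K_obj_in] arr_map[OF q_hom] arr_map[OF R_hom] this]]
  show "kappa C cm T f \<in> hom C (tobj T (K_obj C cm T f)) (apex (T2_span C cm T f))"
    and "proj0 (T2_span C cm T f) \<cdot> kappa C cm T f = tarr T (q_arr C cm T f)"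
    and "proj1 (T2_span C cm T f) \<cdot> kappa C cm T f = tarr T (R_arr C cm T f)"
    by (simp_all add: kappa_def)
qed

text \<open>The projections of \<open>T2_span\<close> turn \<open>kappa\<close> into
  \<open>Tq\<close> and \<open>TR\<close>, so an inequality after \<open>kappa\<close> can be
  checked after these two maps.\<close>

lemma kappa_leI:
  assumes h: "h \<in> hom C W (tobj T (K_obj C cm T f))" and k: "k \<in> hom C W (tobj T (K_obj C cm T f))"
    and "tarr T (q_arr C cm T f) \<cdot> h \<sqsubseteq> tarr T (q_arr C cm T f) \<cdot> k"
    and "tarr T (R_arr C cm T f) \<cdot> h \<sqsubseteq> tarr T (R_arr C cm T f) \<cdot> k"
  shows "kappa C cm T f \<cdot> h \<sqsubseteq> kappa C cm T f \<cdot> k"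
proof (rule is_comma_leI[OF T2_comma hom_objs(1)[OF h] comp_hom[OF kappa_hom h]
      comp_hom[OF kappa_hom k]])
  show "proj0 (T2_span C cm T f) \<cdot> kappa C cm T f \<cdot> h
      \<sqsubseteq> proj0 (T2_span C cm T f) \<cdot> kappa C cm T f \<cdot> k"
    using assms(3) comp_assoc[OF T2_hom(2) kappa_hom h] comp_assoc[OF T2_hom(2) kappa_hom k]
    by (simp add: proj0_kappa)
  show "proj1 (T2_span C cm T f) \<cdot> kappa C cm T f \<cdot> h
      \<sqsubseteq> proj1 (T2_span C cm T f) \<cdot> kappa C cm T f \<cdot> k"
    using assms(4) comp_assoc[OF T2_hom(3) kappa_hom h] comp_assoc[OF T2_hom(3) kappa_hom k]
    by (simp add: proj1_kappa)
qed

lemma TL_q_hom: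
  "tarr T (L_arr C cm T f) \<cdot> q_arr C cm T f \<in> hom C (K_obj C cm T f) (tobj T (K_obj C cm T f))"
  using comp_hom[OF arr_map[OF L_hom] q_hom] .

text \<open>The assignment \<open>u\<close> to \<open>mult T K \<cdot> tarr T u\<close> transposes
  morphisms from \<open>K = Kf\<close> to \<open>TK\<close> into endomorphisms of the free algebra
  on \<open>K\<close>. It is monotone and sends the unit to the identity.\<close>

lemma simple_at:
  assumes "tarr T (L_arr C cm T f) \<cdot> q_arr C cm T f \<sqsubseteq> unit T (K_obj C cm T f)"
  shows "tarr T (L_arr C cm T f) \<cdot> mult T X \<cdot> tarr T (q_arr C cm T f)
    \<sqsubseteq> \<one> (tobj T (K_obj C cm T f))"
proof -
  let ?K = "K_obj C cm T f" and ?L = "L_arr C cm T f" and ?q = "q_arr C cm T f"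
  note TL = arr_map[OF L_hom] and Tq = arr_map[OF q_hom] and \<mu>K = mult_hom[OF K_obj_in]
    and \<eta>K = unit_hom[OF K_obj_in]
  \<comment> \<open>Naturality of the multiplication at \<open>Lf\<close> exhibits the left side as
    the transpose of \<open>tarr T ?L \<cdot> ?q\<close>.\<close>
  have "tarr T ?L \<cdot> mult T X \<cdot> tarr T ?q = (mult T ?K \<cdot> tarr T (tarr T ?L)) \<cdot> tarr T ?q"
    using comp_assoc[OF TL mult_hom[OF obj_X] Tq] mult_natural[OF L_hom] by simp
  also have "\<dots> = mult T ?K \<cdot> tarr T (tarr T ?L \<cdot> ?q)"
    using comp_assoc[OF \<mu>K arr_map[OF TL] Tq] map_comp[OF TL q_hom] by simp
  also have "\<dots> \<sqsubseteq> mult T ?K \<cdot> tarr T (unit T ?K)"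
    using comp_le_right[OF arr_map[OF TL_q_hom] arr_map[OF \<eta>K]
        arr_le[OF TL_q_hom \<eta>K assms K_obj_in obj_map[OF K_obj_in]] \<mu>K] .
  finally show ?thesis
    by (simp add: mult_map_unit[OF K_obj_in])
qed

end

end

lemma (in lax_idempotent_ord_monad) kappa_TL_q_le:
  assumes cm: "comma_choice C cm" and f: "f \<in> hom C X Y"
  shows "kappa C cm T f \<cdot> tarr T (L_arr C cm T f) \<cdot> q_arr C cm T f
    \<sqsubseteq> kappa C cm T f \<cdot> unit T (K_obj C cm T f)"
proof (rule kappa_leI[OF cm f TL_q_hom[OF cm f] unit_hom[OF K_obj_in[OF cm f]]])
  let ?K = "K_obj C cm T f" and ?L = "L_arr C cm T f" and ?q = "q_arr C cm T f"
    and ?R = "R_arr C cm T f"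
  note X = obj_X[OF cm f] and L = L_hom[OF cm f] and q = q_hom[OF cm f] and R = R_hom[OF cm f]
  \<comment> \<open>First projection: \<open>q_L\<close> collapses \<open>Tq \<cdot> TL\<close> to
    \<open>tarr T (unit T X)\<close>, the smaller side of lax idempotency.\<close>
  have "tarr T ?q \<cdot> tarr T ?L \<cdot> ?q = tarr T (unit T X) \<cdot> ?q"
    using comp_assoc[OF arr_map[OF q] arr_map[OF L] q] map_comp[OF q L] q_L[OF cm f] by simp
  also have "\<dots> \<sqsubseteq> unit T (tobj T X) \<cdot> ?q"
    using comp_le_left[OF arr_map[OF unit_hom[OF X]] unit_hom[OF obj_map[OF X]]
        lax_idempotent[OF X] q] .
  finally show "tarr T ?q \<cdot> tarr T ?L \<cdot> ?q \<sqsubseteq> tarr T ?q \<cdot> unit T ?K"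
    by (simp add: unit_natural[OF q])
  \<comment> \<open>Second projection: \<open>R_L\<close> collapses \<open>TR \<cdot> TL\<close> to
    \<open>Tf\<close>, which leaves the inequality defining \<open>Kf\<close>, up to naturality of
    the unit at \<open>Rf\<close>.\<close>
  have "tarr T ?R \<cdot> tarr T ?L \<cdot> ?q = tarr T f \<cdot> ?q"
    using comp_assoc[OF arr_map[OF R] arr_map[OF L] q] map_comp[OF R L] R_L[OF cm f] by simp
  then show "tarr T ?R \<cdot> tarr T ?L \<cdot> ?q \<sqsubseteq> tarr T ?R \<cdot> unit T ?K"
    using q_le_R[OF cm f] by (simp add: unit_natural[OF R])
qed

theorem proposition11p9:
  fixes C :: "('o, 'm) ordcat"
    and cm :: "'m \<Rightarrow> 'm \<Rightarrow> ('o, 'm) span"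
    and T :: "('o, 'm) monad"
  assumes "ord_category C"
    and "comma_choice C cm"
    and "has_pullbacks C"
    and "lax_idempotent_ord_monad C T"
    and "\<And>f X Y u. \<lbrakk>f \<in> hom C X Y; u \<in> hom C (K_obj C cm T f) (tobj T (K_obj C cm T f));
           kappa C cm T f \<cdot>\<^bsub>C\<^esub> u \<sqsubseteq>\<^bsub>C\<^esub> kappa C cm T f \<cdot>\<^bsub>C\<^esub> unit T (K_obj C cm T f)\<rbrakk>
         \<Longrightarrow> u \<sqsubseteq>\<^bsub>C\<^esub> unit T (K_obj C cm T f)"
  shows "simple C cm T"
  unfolding simple_iff
proof
  interpret lax_idempotent_ord_monad C T by fact
  fix f
  assume "f \<in> Arr C"
  then have f: "f \<in> hom C (Dom C f) (Cod C f)"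
    by (simp add: hom_def)
  note cm = \<open>comma_choice C cm\<close>
  \<comment> \<open>The hypothesis is instantiated with \<open>u\<close> as the composite typed in
    \<open>TL_q_hom\<close>.\<close>
  from assms(5)[OF f TL_q_hom[OF cm f] kappa_TL_q_le[OF cm f]]
  show "tarr T (L_arr C cm T f) \<cdot>\<^bsub>C\<^esub> mult T (Dom C f) \<cdot>\<^bsub>C\<^esub> tarr T (q_arr C cm T f)
      \<sqsubseteq>\<^bsub>C\<^esub> \<one>\<^bsub>C\<^esub> (tobj T (K_obj C cm T f))"
    by (rule simple_at[OF cm f])
qed

end
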